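(* Let $(X,\Delta)$ be a complete strong $b$-suprametric space or a complete suprametric space, let $\theta\in\Theta_1$, and let $T:X\to X$ be a mapping that has bounded orbits and satisfies $$\Delta(Tx,Ty)\le\theta\big(\max\{\Delta(x,y),\Delta(x,Tx),\Delta(y,Ty)\}\big)\quad\text{for all }x,y\in X.$$ Then $T$ has a unique fixed point $z$, and for each $x\in X$ the sequence $\{T^nx\}$ converges to $z$.
   Context: A semi-metric on a set $X$ is a function $\Delta:X\times X\to[0,\infty)$ with $\Delta(x,y)=0$ if and only if $x=y$, and $\Delta(x,y)=\Delta(y,x)$ for all $x,y\in X$. A semi-metric $\Delta$ is a strong $b$-suprametric if there exist constants $s\ge1$, $c\ge0$ such that for all $x,y,z\in X$, $\Delta(x,y)\le s\,\Delta(x,z)+\Delta(z,y)+c\,\Delta(x,z)\Delta(z,y)$. It is a suprametric if there exists $c\ge0$ such that for all $x,y,z\in X$, $\Delta(x,y)\le\Delta(x,z)+\Delta(z,y)+c\,\Delta(x,z)\Delta(z,y)$. Then $(X,\Delta)$ is called a strong $b$-suprametric space, respectively a suprametric space. A sequence $\{x_n\}$ in $X$ converges to $a\in X$ if $\Delta(x_n,a)\to0$. It is Cauchy if for every $\epsilon>0$ there is $m_0\in\mathbb N$ with $\Delta(x_n,x_m)<\epsilon$ for all $n,m>m_0$. $(X,\Delta)$ is complete if every Cauchy sequence in $X$ converges to a point of $X$. A subset $Y\subset X$ is bounded if there is $M>0$ with $\Delta(x,y)\le M$ for all $x,y\in Y$. The orbit of $x\in X$ under $T$ is the sequence $\{T^nx\}_{n=0}^\infty$,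 with $T^0x=x$, $T^{n+1}x=T(T^nx)$. $T$ has bounded orbits if for every $x\in X$ the set $\{T^nx: n\ge0\}$ is bounded. $\Theta_1$ is the set of non-decreasing functions $\theta:[0,\infty)\to[0,\infty)$ such that $\theta^n(t)\to0$ as $n\to\infty$ for each $t>0$, where $\theta^n$ is the $n$-fold iterate. *)

theory Defs
  imports Complex_Main "HOL-Library.FuncSet"
begin

text \<open>Spaces are given by a carrier set \<open>X\<close> and a distance function \<open>\<Delta>\<close>; only the
  values of \<open>\<Delta>\<close> on \<open>X \<times> X\<close> are constrained or used.\<close>

definition semi_metric :: "'a set \<Rightarrow> ('a \<Rightarrow> 'a \<Rightarrow> real) \<Rightarrow> bool" where
  "semi_metric X \<Delta> \<longleftrightarrow>
     (\<forall>x\<in>X. \<forall>y\<in>X. 0 \<le> \<Delta> x y) \<and>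
     (\<forall>x\<in>X. \<forall>y\<in>X. \<Delta> x y = 0 \<longleftrightarrow> x = y) \<and>
     (\<forall>x\<in>X. \<forall>y\<in>X. \<Delta> x y = \<Delta> y x)"

definition strong_b_suprametric :: "'a set \<Rightarrow> ('a \<Rightarrow> 'a \<Rightarrow> real) \<Rightarrow> bool" where
  "strong_b_suprametric X \<Delta> \<longleftrightarrow> semi_metric X \<Delta> \<and>
     (\<exists>s\<ge>1. \<exists>c\<ge>0. \<forall>x\<in>X. \<forall>y\<in>X. \<forall>z\<in>X.
        \<Delta> x y \<le> s * \<Delta> x z + \<Delta> z y + c * \<Delta> x z * \<Delta> z y)"

definition suprametric :: "'a set \<Rightarrow> ('a \<Rightarrow> 'a \<Rightarrow> real) \<Rightarrow> bool" where
  "suprametric X \<Delta> \<longleftrightarrow> semi_metric X \<Delta> \<and>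
     (\<exists>c\<ge>0. \<forall>x\<in>X. \<forall>y\<in>X. \<forall>z\<in>X.
        \<Delta> x y \<le> \<Delta> x z + \<Delta> z y + c * \<Delta> x z * \<Delta> z y)"

definition sm_converges :: "('a \<Rightarrow> 'a \<Rightarrow> real) \<Rightarrow> (nat \<Rightarrow> 'a) \<Rightarrow> 'a \<Rightarrow> bool" where
  "sm_converges \<Delta> \<sigma> a \<longleftrightarrow> (\<lambda>n. \<Delta> (\<sigma> n) a) \<longlonglongrightarrow> 0"

definition sm_Cauchy :: "('a \<Rightarrow> 'a \<Rightarrow> real) \<Rightarrow> (nat \<Rightarrow> 'a) \<Rightarrow> bool" where
  "sm_Cauchy \<Delta> \<sigma> \<longleftrightarrow> (\<forall>\<epsilon>>0. \<exists>m\<^sub>0. \<forall>n>m\<^sub>0. \<forall>m>m\<^sub>0. \<Delta> (\<sigma> n) (\<sigma> m) < \<epsilon>)"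

definition sm_complete :: "'a set \<Rightarrow> ('a \<Rightarrow> 'a \<Rightarrow> real) \<Rightarrow> bool" where
  "sm_complete X \<Delta> \<longleftrightarrow>
     (\<forall>\<sigma>. range \<sigma> \<subseteq> X \<and> sm_Cauchy \<Delta> \<sigma> \<longrightarrow> (\<exists>a\<in>X. sm_converges \<Delta> \<sigma> a))"

definition sm_bounded :: "('a \<Rightarrow> 'a \<Rightarrow> real) \<Rightarrow> 'a set \<Rightarrow> bool" where
  "sm_bounded \<Delta> Y \<longleftrightarrow> (\<exists>M>0. \<forall>x\<in>Y. \<forall>y\<in>Y. \<Delta> x y \<le> M)"

definition bounded_orbits :: "'a set \<Rightarrow> ('a \<Rightarrow> 'a \<Rightarrow> real) \<Rightarrow> ('a \<Rightarrow> 'a) \<Rightarrow> bool" where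
  "bounded_orbits X \<Delta> T \<longleftrightarrow> (\<forall>x\<in>X. sm_bounded \<Delta> (range (\<lambda>n. (T ^^ n) x)))"

text \<open>A map from \<open>[0,\<infinity>)\<close> to itself is a function on the reals of which only the
  restriction to \<open>{0..}\<close> is relevant.\<close>

definition Theta1 :: "(real \<Rightarrow> real) set" where
  "Theta1 = {\<theta>. \<theta> \<in> {0..} \<rightarrow> {0..} \<and> mono_on {0..} \<theta> \<and>
                (\<forall>t>0. (\<lambda>n. (\<theta> ^^ n) t) \<longlonglongrightarrow> 0)}"

end

theory Submission
  imports Defs
begin

text \<open>If \<open>M\<close> bounds the diameter of an orbit, then, by induction and monotonicity of \<open>\<theta>\<close>,
  \<open>\<theta>\<^sup>n M\<close> bounds the diameter of its \<open>n\<close>-th tail, because with \<open>x\<close> and \<open>y\<close> the points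
  \<open>T x\<close> and \<open>T y\<close> also lie in the tail. So orbits are Cauchy. If an orbit converges to \<open>z\<close>
  and \<open>d = \<Delta> z (T z) > 0\<close>, then eventually \<open>\<Delta> (T\<^sup>n\<^sup>+\<^sup>1 x) (T z) \<le> \<theta> d\<close>; since the second
  term of the strong \<open>b\<close>-inequality has coefficient 1, passing to the limit gives
  \<open>d \<le> \<theta> d < d\<close>.\<close>

text \<open>The witness is \<open>s = 1\<close>; this lets the convergence argument be carried out
  once for both kinds of space.\<close>

lemma suprametric_imp_strong_b_suprametric:
  assumes "suprametric X \<Delta>"
  shows "strong_b_suprametric X \<Delta>"
proof -
  obtain c where "c \<ge> 0"
    "\<forall>x\<in>X. \<forall>y\<in>X. \<forall>z\<in>X. \<Delta> x y \<le> 1 * \<Delta> x z + \<Delta> z y + c * \<Delta> x z * \<Delta> z y"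
    using assms unfolding suprametric_def by auto
  then show ?thesis
    using assms unfolding suprametric_def strong_b_suprametric_def by blast
qed

text \<open>If \<open>t \<le> \<theta> t\<close>, monotonicity keeps every iterate at or above
  \<open>t > 0\<close>, so the iterates cannot tend to 0.\<close>

lemma Theta1_less:
  assumes \<theta>: "\<theta> \<in> Theta1" and "0 < t"
  shows "\<theta> t < t"
proof (rule ccontr)
  assume "\<not> \<theta> t < t"
  then have *: "t \<le> \<theta> t" by simp
  have mono: "mono_on {0..} \<theta>" and lim: "(\<lambda>n. (\<theta> ^^ n) t) \<longlonglongrightarrow> 0"
    using assms by (auto simp: Theta1_def)
  have "t \<le> (\<theta> ^^ n) t" for n
  proof (induction n)
    case (Suc n)
    have "\<theta> t \<le> \<theta> ((\<theta> ^^ n) t)"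
      using mono Suc \<open>0 < t\<close> by (auto intro: mono_onD)
    then show ?case using * by simp
  qed simp
  with lim have "t \<le> 0" by (intro LIMSEQ_le_const) auto
  with \<open>0 < t\<close> show False by simp
qed

lemma funpow_in_carrier:
  assumes "T \<in> X \<rightarrow> X" "x \<in> X"
  shows "(T ^^ n) x \<in> X"
  using assms by (induction n) auto

lemma orbit_tail_diameter:
  assumes sm: "semi_metric X \<Delta>" and \<theta>: "\<theta> \<in> Theta1" and T: "T \<in> X \<rightarrow> X"
    and contr: "\<forall>x\<in>X. \<forall>y\<in>X. \<Delta> (T x) (T y) \<le> \<theta> (Max {\<Delta> x y, \<Delta> x (T x), \<Delta> y (T y)})"
    and x: "x \<in> X" and bound: "\<And>i j. \<Delta> ((T ^^ i) x) ((T ^^ j) x) \<le> M"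
    and "n \<le> i" "n \<le> j"
  shows "\<Delta> ((T ^^ i) x) ((T ^^ j) x) \<le> (\<theta> ^^ n) M"
  using \<open>n \<le> i\<close> \<open>n \<le> j\<close>
proof (induction n arbitrary: i j)
  case 0
  then show ?case using bound by simp
next
  case (Suc n)
  obtain i' j' where ij: "i = Suc i'" "j = Suc j'" "n \<le> i'" "n \<le> j'"
    using Suc.prems by (metis Suc_le_D Suc_le_mono)
  let ?u = "(T ^^ i') x" and ?v = "(T ^^ j') x"
  let ?m = "Max {\<Delta> ?u ?v, \<Delta> ?u (T ?u), \<Delta> ?v (T ?v)}"
  have in_X: "?u \<in> X" "?v \<in> X"
    using funpow_in_carrier[OF T x] by auto
  \<comment> \<open>\<open>T ?u\<close> and \<open>T ?v\<close> are the orbit points with indices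
    \<open>Suc i'\<close> and \<open>Suc j'\<close>, so the induction hypothesis, available for all
    index pairs from \<open>n\<close> on, bounds all three entries of the maximum.\<close>
  have "\<Delta> ?u ?v \<le> (\<theta> ^^ n) M" "\<Delta> ?u (T ?u) \<le> (\<theta> ^^ n) M" "\<Delta> ?v (T ?v) \<le> (\<theta> ^^ n) M"
    using Suc.IH[of i' j'] Suc.IH[of i' "Suc i'"] Suc.IH[of j' "Suc j'"] ij by auto
  then have le: "?m \<le> (\<theta> ^^ n) M" by simp
  \<comment> \<open>\<theta> is monotone on \<open>{0..}\<close> only, so the maximum must be shown
    to lie there; one nonnegative entry suffices.\<close>
  have "0 \<le> \<Delta> ?u ?v"
    using sm in_X by (auto simp: semi_metric_def)
  then have "0 \<le> ?m" by (simp add: le_max_iff_disj)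
  moreover have "mono_on {0..} \<theta>" using \<theta> by (simp add: Theta1_def)
  ultimately have "\<theta> ?m \<le> \<theta> ((\<theta> ^^ n) M)"
    using le by (auto intro: mono_onD)
  moreover have "\<Delta> (T ?u) (T ?v) \<le> \<theta> ?m" using contr in_X by blast
  ultimately show ?case using ij by simp
qed

lemma orbit_Cauchy:
  assumes sm: "semi_metric X \<Delta>" and \<theta>: "\<theta> \<in> Theta1" and T: "T \<in> X \<rightarrow> X"
    and orbits: "bounded_orbits X \<Delta> T"
    and contr: "\<forall>x\<in>X. \<forall>y\<in>X. \<Delta> (T x) (T y) \<le> \<theta> (Max {\<Delta> x y, \<Delta> x (T x), \<Delta> y (T y)})"
    and x: "x \<in> X"
  shows "sm_Cauchy \<Delta> (\<lambda>n. (T ^^ n) x)"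
  unfolding sm_Cauchy_def
proof (intro allI impI)
  fix \<epsilon> :: real assume "\<epsilon> > 0"
  obtain M where M: "M > 0" "\<And>i j. \<Delta> ((T ^^ i) x) ((T ^^ j) x) \<le> M"
    using orbits x unfolding bounded_orbits_def sm_bounded_def by blast
  \<comment> \<open>The bound \<open>M\<close> is positive, and \<open>Theta1\<close> gives
    convergence of the iterates at positive arguments.\<close>
  have "(\<lambda>n. (\<theta> ^^ n) M) \<longlonglongrightarrow> 0" using \<theta> M by (simp add: Theta1_def)
  then have "\<forall>\<^sub>F n in sequentially. (\<theta> ^^ n) M < \<epsilon>"
    using \<open>\<epsilon> > 0\<close> by (rule order_tendstoD)
  then obtain N where N: "(\<theta> ^^ N) M < \<epsilon>"
    by (auto simp: eventually_sequentially)
  have "\<Delta> ((T ^^ n) x) ((T ^^ m) x) < \<epsilon>" if "n > N" "m > N" for n m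
    using orbit_tail_diameter[OF sm \<theta> T contr x M(2), of N n m] N that by simp
  then show "\<exists>m\<^sub>0. \<forall>n>m\<^sub>0. \<forall>m>m\<^sub>0. \<Delta> ((T ^^ n) x) ((T ^^ m) x) < \<epsilon>" by blast
qed

lemma orbit_limit_fixed:
  assumes sb: "strong_b_suprametric X \<Delta>" and \<theta>: "\<theta> \<in> Theta1" and T: "T \<in> X \<rightarrow> X"
    and contr: "\<forall>x\<in>X. \<forall>y\<in>X. \<Delta> (T x) (T y) \<le> \<theta> (Max {\<Delta> x y, \<Delta> x (T x), \<Delta> y (T y)})"
    and x: "x \<in> X" and z: "z \<in> X"
    and cauchy: "sm_Cauchy \<Delta> (\<lambda>n. (T ^^ n) x)"
    and conv: "sm_converges \<Delta> (\<lambda>n. (T ^^ n) x) z"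
  shows "T z = z"
proof (rule ccontr)
  assume "T z \<noteq> z"
  have sm: "semi_metric X \<Delta>" using sb by (simp add: strong_b_suprametric_def)
  obtain s c where sc: "s \<ge> 1" "c \<ge> 0"
    and tri: "\<And>x y z. x \<in> X \<Longrightarrow> y \<in> X \<Longrightarrow> z \<in> X \<Longrightarrow>
      \<Delta> x y \<le> s * \<Delta> x z + \<Delta> z y + c * \<Delta> x z * \<Delta> z y"
    using sb unfolding strong_b_suprametric_def by blast
  have nonneg: "0 \<le> \<Delta> u v" and commute: "\<Delta> u v = \<Delta> v u" if "u \<in> X" "v \<in> X" for u v
    using sm that by (auto simp: semi_metric_def)
  define d where "d = \<Delta> z (T z)"
  define a where "a = (\<lambda>n. \<Delta> ((T ^^ n) x) z)"
  have Tz: "T z \<in> X" using T z by auto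
  have orb: "(T ^^ n) x \<in> X" for n using funpow_in_carrier[OF T x] .
  have "d \<noteq> 0" using sm z Tz \<open>T z \<noteq> z\<close> by (auto simp: semi_metric_def d_def)
  then have d: "d > 0" using nonneg[OF z Tz] by (simp add: d_def)
  have a: "a \<longlonglongrightarrow> 0" using conv unfolding sm_converges_def a_def .
  have "\<forall>\<^sub>F n in sequentially. a n < d" using a d by (rule order_tendstoD)
  moreover obtain N where N: "\<And>n m. n > N \<Longrightarrow> m > N \<Longrightarrow> \<Delta> ((T ^^ n) x) ((T ^^ m) x) < d"
    using cauchy d unfolding sm_Cauchy_def by blast
  have "\<forall>\<^sub>F n in sequentially. n > N" by (rule eventually_gt_at_top)
  \<comment> \<open>The distance from \<open>(T ^^ Suc n) x\<close> to \<open>T z\<close> is not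
    known to converge, so it is replaced by its bound \<open>\<theta> d\<close>; the right-hand side
    then has a limit.\<close>
  ultimately have ev: "\<forall>\<^sub>F n in sequentially. d \<le> s * a (Suc n) + \<theta> d + c * a (Suc n) * \<theta> d"
  proof eventually_elim
    case (elim n)
    have "\<Delta> ((T ^^ n) x) (T ((T ^^ n) x)) < d" using N[of n "Suc n"] elim by simp
    \<comment> \<open>With \<open>d\<close> as the threshold both for \<open>a n\<close> and for
      consecutive orbit distances, the entry \<open>\<Delta> z (T z)\<close> dominates and the
      maximum is exactly \<open>d\<close>.\<close>
    then have "Max {\<Delta> ((T ^^ n) x) z, \<Delta> ((T ^^ n) x) (T ((T ^^ n) x)), \<Delta> z (T z)} = d"
      using elim(1) by (simp add: a_def d_def)
    then have le: "\<Delta> ((T ^^ Suc n) x) (T z) \<le> \<theta> d"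
      using contr orb[of n] z by (metis comp_apply funpow.simps(2))
    have "0 \<le> a (Suc n)" using nonneg orb z by (simp add: a_def del: funpow.simps)
    then have "c * a (Suc n) * \<Delta> ((T ^^ Suc n) x) (T z) \<le> c * a (Suc n) * \<theta> d"
      using sc le by (intro mult_left_mono) auto
    \<comment> \<open>The intermediate point is \<open>(T ^^ Suc n) x\<close>, and the order of the
      arguments puts the factor \<open>s\<close> on \<open>a (Suc n)\<close>, which vanishes in the
      limit.\<close>
    moreover have "d \<le> s * a (Suc n) + \<Delta> ((T ^^ Suc n) x) (T z)
        + c * a (Suc n) * \<Delta> ((T ^^ Suc n) x) (T z)"
      using tri[OF z Tz orb[of "Suc n"]] commute[OF z orb[of "Suc n"]]
      by (simp add: a_def d_def del: funpow.simps)
    ultimately show ?case using le by linarith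
  qed
  have "(\<lambda>n. s * a (Suc n) + \<theta> d + c * a (Suc n) * \<theta> d) \<longlonglongrightarrow> s * 0 + \<theta> d + c * 0 * \<theta> d"
    using a by (intro tendsto_intros LIMSEQ_Suc)
  then have "d \<le> s * 0 + \<theta> d + c * 0 * \<theta> d"
    using ev by (rule tendsto_lowerbound) simp
  with Theta1_less[OF \<theta> d] show False by simp
qed

text \<open>At two fixed points the displacement entries of the maximum are 0, so the contraction
  gives \<open>\<Delta> w z \<le> \<theta> (\<Delta> w z)\<close>, which is impossible for a
  positive distance.\<close>

lemma fixed_point_unique:
  assumes sm: "semi_metric X \<Delta>" and \<theta>: "\<theta> \<in> Theta1"
    and contr: "\<forall>x\<in>X. \<forall>y\<in>X. \<Delta> (T x) (T y) \<le> \<theta> (Max {\<Delta> x y, \<Delta> x (T x), \<Delta> y (T y)})"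
    and "w \<in> X" "T w = w" "z \<in> X" "T z = z"
  shows "w = z"
proof (rule ccontr)
  assume "w \<noteq> z"
  have zero: "\<Delta> w w = 0" "\<Delta> z z = 0" and pos: "0 < \<Delta> w z"
    using sm assms(4,6) \<open>w \<noteq> z\<close> by (auto simp: semi_metric_def order_less_le)
  have "\<Delta> (T w) (T z) \<le> \<theta> (Max {\<Delta> w z, \<Delta> w (T w), \<Delta> z (T z)})"
    using contr assms(4,6) by blast
  with zero pos assms(5,7) have "\<Delta> w z \<le> \<theta> (\<Delta> w z)" by simp
  with Theta1_less[OF \<theta> pos] show False by simp
qed

theorem corollary1:
  fixes X :: "'a set" and \<Delta> :: "'a \<Rightarrow> 'a \<Rightarrow> real"
    and \<theta> :: "real \<Rightarrow> real" and T :: "'a \<Rightarrow> 'a"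
  assumes "X \<noteq> {}"
    and "strong_b_suprametric X \<Delta> \<or> suprametric X \<Delta>"
    and "sm_complete X \<Delta>"
    and "\<theta> \<in> Theta1"
    and "T \<in> X \<rightarrow> X"
    and "bounded_orbits X \<Delta> T"
    and "\<forall>x\<in>X. \<forall>y\<in>X. \<Delta> (T x) (T y) \<le> \<theta> (Max {\<Delta> x y, \<Delta> x (T x), \<Delta> y (T y)})"
  shows "\<exists>z\<in>X. T z = z \<and> (\<forall>w\<in>X. T w = w \<longrightarrow> w = z) \<and>
           (\<forall>x\<in>X. sm_converges \<Delta> (\<lambda>n. (T ^^ n) x) z)"
proof -
  have sb: "strong_b_suprametric X \<Delta>"
    using assms(2) suprametric_imp_strong_b_suprametric by blast
  then have sm: "semi_metric X \<Delta>" by (simp add: strong_b_suprametric_def)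
  have lim: "\<exists>z\<in>X. T z = z \<and> sm_converges \<Delta> (\<lambda>n. (T ^^ n) x) z" if x: "x \<in> X" for x
  proof -
    have cauchy: "sm_Cauchy \<Delta> (\<lambda>n. (T ^^ n) x)"
      using orbit_Cauchy[OF sm assms(4-7) x] .
    moreover have "range (\<lambda>n. (T ^^ n) x) \<subseteq> X"
      using funpow_in_carrier[OF assms(5) x] by auto
    ultimately obtain z where "z \<in> X" "sm_converges \<Delta> (\<lambda>n. (T ^^ n) x) z"
      using assms(3) unfolding sm_complete_def by blast
    then show ?thesis
      using orbit_limit_fixed[OF sb assms(4,5,7) x _ cauchy] by blast
  qed
  obtain z where z: "z \<in> X" "T z = z" using lim assms(1) by blast
  have "w = z" if "w \<in> X" "T w = w" for w
    using fixed_point_unique[OF sm assms(4,7) that z] .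
  \<comment> \<open>A priori each orbit has its own limit; every such limit is a fixed point, so
    uniqueness identifies it with \<open>z\<close>.\<close>
  with lim z show ?thesis by metis
qed

end
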